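(* Let $\mathbf{v}_1,\ldots,\mathbf{v}_n\in\mathbb{C}^d$ and $\tau_1,\ldots,\tau_n>0$ satisfy $\sum_{i=1}^n\tau_i^2(\mathbf{v}_i\mathbf{v}_i^* )^2\preceq\mathbf{I}$. Define the univariate polynomial $$p_\emptyset(x)=\prod_{i=1}^n\Big(1-\frac12\partial_{z_i}^2\Big)\Big|_{z_i=0}\det\Big[x\mathbf{I}+\sum_{i=1}^n z_i\tau_i\mathbf{v}_i\mathbf{v}_i^*\Big]^2,$$ i.e. apply the operators $1-\frac12\partial_{z_i}^2$ for all $i$ to the polynomial in $(x,z_1,\ldots,z_n)$ and then set $z_1=\cdots=z_n=0$. Then the largest root of $p_\emptyset$ is at most $3$.
   Context: $\preceq$ denotes the Loewner order on Hermitian matrices. *)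

theory Defs
  imports "HOL-Analysis.Analysis"
begin

definition adjoint_mat :: "complex ^'n ^'m \<Rightarrow> complex ^'m ^'n" where
  "adjoint_mat A = (\<chi> i j. cnj (A $ j $ i))"

definition outer :: "complex ^'d \<Rightarrow> complex ^'d ^'d" where
  "outer v = (\<chi> i j. v $ i * cnj (v $ j))"

definition hermitian :: "complex ^'d ^'d \<Rightarrow> bool" where
  "hermitian A \<longleftrightarrow> adjoint_mat A = A"

definition scaleM :: "complex \<Rightarrow> complex ^'n ^'m \<Rightarrow> complex ^'n ^'m" where
  "scaleM c A = (\<chi> i j. c * A $ i $ j)"

definition qform :: "complex ^'d ^'d \<Rightarrow> complex ^'d \<Rightarrow> complex" where
  "qform A w = (\<Sum>i\<in>UNIV. cnj (w $ i) * (A *v w) $ i)"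

definition psd :: "complex ^'d ^'d \<Rightarrow> bool" where
  "psd A \<longleftrightarrow> hermitian A \<and> (\<forall>w. Im (qform A w) = 0 \<and> 0 \<le> Re (qform A w))"

definition loewner_le :: "complex ^'d ^'d \<Rightarrow> complex ^'d ^'d \<Rightarrow> bool" where
  "loewner_le A B \<longleftrightarrow> hermitian A \<and> hermitian B \<and> psd (B - A)"

definition op_i :: "nat \<Rightarrow> ((nat \<Rightarrow> complex) \<Rightarrow> complex) \<Rightarrow> ((nat \<Rightarrow> complex) \<Rightarrow> complex)" where
  "op_i i F = (\<lambda>z. F z - 1/2 * deriv (deriv (\<lambda>t. F (z(i := t)))) (z i))"

primrec ops :: "nat \<Rightarrow> ((nat \<Rightarrow> complex) \<Rightarrow> complex) \<Rightarrow> ((nat \<Rightarrow> complex) \<Rightarrow> complex)" where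
  "ops 0 F = F"
| "ops (Suc n) F = op_i n (ops n F)"

definition p_empty :: "nat \<Rightarrow> (nat \<Rightarrow> real) \<Rightarrow> (nat \<Rightarrow> complex ^'d) \<Rightarrow> complex \<Rightarrow> complex" where
  "p_empty n \<tau> v x =
     ops n (\<lambda>z. (det (mat x + (\<Sum>i<n. scaleM (z i * complex_of_real (\<tau> i)) (outer (v i))))) ^ 2) (\<lambda>_. 0)"

end

theory Submission
  imports Defs
begin

text \<open>
  For real \<open>x > 3\<close> the polynomial \<open>f z = det (x I + \<Sum> z\<^sub>i \<tau>\<^sub>i v\<^sub>i v\<^sub>i\<^sup>*)\<^sup>2\<close> is real stable and has
  degree at most 2 in each variable; the operators preserve both properties, and real
  stability gives \<open>F \<partial>\<^sub>i \<partial>\<^sub>j F \<le> \<partial>\<^sub>i F \<partial>\<^sub>j F\<close> on real points, so the logarithmic derivatives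
  \<open>\<partial>\<^sub>j F / F\<close> decrease along every coordinate as long as \<open>F > 0\<close>. Start at the point
  \<open>z\<^sub>i = - \<delta>\<^sub>i\<close> with \<open>\<delta>\<^sub>i = t \<tau>\<^sub>i \<bar>v\<^sub>i\<bar>\<^sup>2\<close>: by the Loewner bound the matrix is at least
  \<open>(x - t) I\<close> there, so \<open>\<partial>\<^sub>j f \<le> \<beta>\<^sub>j f\<close> with \<open>\<beta>\<^sub>j = 2 \<tau>\<^sub>j \<bar>v\<^sub>j\<bar>\<^sup>2 / (x - t)\<close>. Each operator is applied
  together with the shift of \<open>z\<^sub>i\<close> from \<open>- \<delta>\<^sub>i\<close> to 0; for a quadratic the result is
  \<open>(F(z) - \<delta>\<^sub>i\<^sup>2 F(z - (1/\<delta>\<^sub>i - \<delta>\<^sub>i) e\<^sub>i)) / (1 - \<delta>\<^sub>i\<^sup>2)\<close>, and from this formula positivity above the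
  point and the bounds \<open>\<beta>\<^sub>j\<close> persist provided \<open>\<beta>\<^sub>i (1/\<delta>\<^sub>i - \<delta>\<^sub>i) < 1\<close>. This holds if \<open>t < 1\<close> and
  \<open>t (x - t) > 2\<close>, and such a \<open>t\<close> exists because \<open>x > 3\<close>.
\<close>

section \<open>Functions that are quadratic in each variable\<close>

text \<open>The coefficients may depend on the other variables, so this stands in for multivariate
  polynomials of degree at most 2 in each variable. The type is left open because both real and
  complex functions occur.\<close>

definition quad :: "((nat \<Rightarrow> 'a::field_char_0) \<Rightarrow> 'a) \<Rightarrow> bool" where
  "quad f \<longleftrightarrow> (\<forall>i z. \<exists>a b c. \<forall>t. f (z(i := t)) = a + b * t + c * t^2)"

text \<open>For functions quadratic in the variable these differences are exactly the first
  partial derivative and half the second one.\<close>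

definition D :: "nat \<Rightarrow> ((nat \<Rightarrow> 'a::field_char_0) \<Rightarrow> 'a) \<Rightarrow> (nat \<Rightarrow> 'a) \<Rightarrow> 'a" where
  "D i f z = (f (z(i := z i + 1)) - f (z(i := z i - 1))) / 2"

definition C :: "nat \<Rightarrow> ((nat \<Rightarrow> 'a::field_char_0) \<Rightarrow> 'a) \<Rightarrow> (nat \<Rightarrow> 'a) \<Rightarrow> 'a" where
  "C i f z = (f (z(i := z i + 1)) + f (z(i := z i - 1))) / 2 - f z"

lemma quadE:
  assumes "quad f"
  obtains a b c where "\<And>t. f (z(i := t)) = a + b * t + c * t^2"
  using assms unfolding quad_def by metis

lemma quad_coeffs:
  assumes "\<And>t. f (z(i := t)) = a + b * t + c * t^2"
  shows "D i f (z(i := t)) = b + 2 * c * t" "C i f (z(i := t)) = c"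
  by (simp_all add: D_def C_def assms field_simps power2_eq_square)

lemma quad_shift:
  assumes "quad f"
  shows "f (z(i := z i + h)) = f z + h * D i f z + h^2 * C i f z"
proof -
  obtain a b c where abc: "\<And>t. f (z(i := t)) = a + b * t + c * t^2"
    using quadE[OF assms] by blast
  have "f z = a + b * z i + c * (z i)^2" "D i f z = b + 2 * c * z i" "C i f z = c"
    using abc[of "z i"] quad_coeffs[OF abc, of "z i"] by simp_all
  then show ?thesis by (simp add: abc algebra_simps power2_eq_square)
qed

lemma D_shift:
  assumes "quad f"
  shows "D i f (z(i := z i + h)) = D i f z + 2 * h * C i f z"
proof -
  obtain a b c where abc: "\<And>t. f (z(i := t)) = a + b * t + c * t^2"
    using quadE[OF assms] by blast
  show ?thesis
    using quad_coeffs[OF abc, of "z i"] by (simp add: quad_coeffs[OF abc] algebra_simps)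
qed

lemma D_D:
  assumes "quad f"
  shows "D i (D i f) z = 2 * C i f z"
  using D_shift[OF assms, of i z 1] D_shift[OF assms, of i z "-1"]
  by (simp add: D_def[of i "D i f"])

lemma quad_lincomb:
  assumes "quad f" "quad g"
  shows "quad (\<lambda>z. r * f z + s * g z)"
  unfolding quad_def
proof (intro allI)
  fix i z
  obtain a b c where 1: "\<And>t. f (z(i := t)) = a + b * t + c * t^2"
    using quadE[OF assms(1)] by blast
  obtain a' b' c' where 2: "\<And>t. g (z(i := t)) = a' + b' * t + c' * t^2"
    using quadE[OF assms(2)] by blast
  have "\<forall>t. r * f (z(i := t)) + s * g (z(i := t)) = (r*a + s*a') + (r*b + s*b') * t + (r*c + s*c') * t^2"
    by (simp add: 1 2 algebra_simps)
  then show "\<exists>a b c. \<forall>t. r * f (z(i := t)) + s * g (z(i := t)) = a + b * t + c * t^2" by blast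
qed

lemma quad_translate:
  assumes "quad f"
  shows "quad (\<lambda>z. f (z(i := z i + h)))"
  unfolding quad_def
proof (intro allI)
  fix j z
  show "\<exists>a b c. \<forall>t. f ((z(j := t))(i := (z(j := t)) i + h)) = a + b * t + c * t^2"
  proof (cases "i = j")
    case True
    obtain a b c where "\<And>t. f (z(i := t)) = a + b * t + c * t^2"
      using quadE[OF assms] by blast
    then have "\<forall>t. f ((z(j := t))(i := (z(j := t)) i + h)) = (a + b*h + c*h^2) + (b + 2*c*h) * t + c * t^2"
      using True by (simp add: algebra_simps power2_eq_square)
    then show ?thesis by blast
  next
    case False
    obtain a b c where "\<And>t. f ((z(i := z i + h))(j := t)) = a + b * t + c * t^2"
      using quadE[OF assms] by blast
    then show ?thesis using False by (simp add: fun_upd_twist[of i j]) blast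
  qed
qed

lemma quad_D:
  assumes "quad f"
  shows "quad (D i f)"
proof -
  have "D i f = (\<lambda>z. 1/2 * f (z(i := z i + 1)) + (-1/2) * f (z(i := z i + (-1))))"
    by (simp add: D_def fun_eq_iff field_simps)
  then show ?thesis by (simp only: quad_lincomb quad_translate assms)
qed

lemma quad_C:
  assumes "quad f"
  shows "quad (C i f)"
proof -
  have "C i f = (\<lambda>z. 1 * (1/2 * f (z(i := z i + 1)) + 1/2 * f (z(i := z i + (-1)))) + (-1) * f z)"
    by (simp add: C_def fun_eq_iff field_simps)
  then show ?thesis by (simp only: quad_lincomb quad_translate assms)
qed

text \<open>Finite differences in distinct variables commute, whatever \<open>f\<close> is.\<close>

lemma D_diff_C:
  assumes "i \<noteq> j"
  shows "D j (\<lambda>z. f z - C i f z) z = D j f z - C i (D j f) z"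
  using assms by (simp add: D_def C_def fun_upd_twist[of i j] field_simps)

section \<open>The barrier step over the reals\<close>

text \<open>The case \<open>i = j\<close> is included; by \<open>D_D\<close> it reads
  \<open>2 * F x * C i F x <= (D i F x)^2\<close> and bounds the curvature by the slope.\<close>

definition rayleigh :: "((nat \<Rightarrow> real) \<Rightarrow> real) \<Rightarrow> bool" where
  "rayleigh F \<longleftrightarrow> quad F \<and> (\<forall>i j x. F x * D i (D j F) x \<le> D i F x * D j F x)"

text \<open>Along the coordinate \<open>i\<close> the quotient rule gives the numerator
  \<open>F * D i (D j F) - D i F * D j F\<close>, which the Rayleigh inequality makes nonpositive;
  \<open>pos\<close> keeps the quotient defined on the whole segment.\<close>

lemma rayleigh_ratio_decreasing:
  assumes F: "rayleigh F" and "0 \<le> h"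
    and pos: "\<And>s. 0 \<le> s \<Longrightarrow> s \<le> h \<Longrightarrow> F (x(i := x i + s)) > 0"
  shows "D j F (x(i := x i + h)) / F (x(i := x i + h)) \<le> D j F x / F x"
proof -
  have q: "quad F" and qD: "quad (D j F)"
    and ray: "\<And>y. F y * D i (D j F) y \<le> D i F y * D j F y"
    using F quad_D by (auto simp: rayleigh_def)
  define N where "N s = D j F x + s * D i (D j F) x + s^2 * C i (D j F) x" for s
  define Q where "Q s = F x + s * D i F x + s^2 * C i F x" for s
  have N: "D j F (x(i := x i + s)) = N s" and Q: "F (x(i := x i + s)) = Q s" for s
    by (simp_all add: N_def Q_def quad_shift[OF q] quad_shift[OF qD])
  have "N h / Q h \<le> N 0 / Q 0"
  proof (rule DERIV_nonpos_imp_nonincreasing[OF \<open>0 \<le> h\<close>])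
    fix s assume s: "0 \<le> s" "s \<le> h"
    have Qpos: "Q s > 0" using pos[OF s] Q by simp
    let ?N' = "D i (D j F) (x(i := x i + s))" and ?Q' = "D i F (x(i := x i + s))"
    have N': "(N has_real_derivative ?N') (at s)"
      unfolding N_def D_shift[OF qD] by (auto intro!: derivative_eq_intros)
    have Q': "(Q has_real_derivative ?Q') (at s)"
      unfolding Q_def D_shift[OF q] by (auto intro!: derivative_eq_intros)
    have "((\<lambda>s. N s / Q s) has_real_derivative (?N' * Q s - N s * ?Q') / (Q s * Q s)) (at s)"
      using DERIV_divide[OF N' Q'] Qpos by simp
    moreover have "(?N' * Q s - N s * ?Q') / (Q s * Q s) \<le> 0"
      using ray[of "x(i := x i + s)"] Qpos
      by (simp add: N Q divide_le_0_iff mult.commute)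
    ultimately show "\<exists>y. ((\<lambda>s. N s / Q s) has_real_derivative y) (at s) \<and> y \<le> 0" by blast
  qed
  then show ?thesis using N[of 0] Q[of 0] N[of h] Q[of h] by simp
qed

text \<open>Coordinates below \<open>k\<close> have already been processed and those from
  \<open>n\<close> on do not occur, so both kinds are frozen; only finitely many coordinates may
  grow.\<close>

definition orthant :: "nat \<Rightarrow> nat \<Rightarrow> (nat \<Rightarrow> real) \<Rightarrow> (nat \<Rightarrow> real) set" where
  "orthant k n x = {y. (\<forall>j. x j \<le> y j) \<and> (\<forall>j. j < k \<or> n \<le> j \<longrightarrow> y j = x j)}"

lemma orthant_ratio_decreasing:
  assumes F: "rayleigh F" and pos: "\<And>y. y \<in> orthant k n x \<Longrightarrow> F y > 0" and y: "y \<in> orthant k n x"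
  shows "D j F y / F y \<le> D j F x / F x"
proof -
  \<comment> \<open>The path from \<open>x\<close> to \<open>y\<close> raises one coordinate at a
    time and stays in the orthant. It has arrived at \<open>m = n\<close>, because the coordinates
    from \<open>n\<close> on agree.\<close>
  define w where "w m = (\<lambda>j. if j < m then y j else x j)" for m
  have "D j F (w m) / F (w m) \<le> D j F x / F x" for m
  proof (induction m)
    case 0
    then show ?case by (simp add: w_def)
  next
    case (Suc m)
    have w: "w (Suc m) = (w m)(m := w m m + (y m - x m))" by (auto simp: w_def)
    have "D j F (w (Suc m)) / F (w (Suc m)) \<le> D j F (w m) / F (w m)"
      unfolding w
    proof (rule rayleigh_ratio_decreasing[OF F])
      show "0 \<le> y m - x m" using y by (simp add: orthant_def)
      fix s assume s: "0 \<le> s" "s \<le> y m - x m"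
      show "F ((w m)(m := w m m + s)) > 0"
      proof (rule pos)
        have "y m = x m" if "m < k \<or> n \<le> m" using y that by (auto simp: orthant_def)
        then show "(w m)(m := w m m + s) \<in> orthant k n x" using y s by (force simp: orthant_def w_def)
      qed
    qed
    then show ?case using Suc by linarith
  qed
  moreover have "w n = y" using y by (auto simp: w_def orthant_def fun_eq_iff)
  ultimately show ?thesis by metis
qed

text \<open>A quadratic that is positive on a ray cannot open downwards. If its initial slope were
  negative, it would vanish on the ray in the affine case; otherwise the Rayleigh inequality for
  \<open>i = j\<close> at its vertex, where the slope is 0, would contradict positivity.\<close>

lemma orthant_derivatives:
  assumes F: "rayleigh F" and pos: "\<And>s. 0 \<le> s \<Longrightarrow> F (y(i := y i + s)) > 0"
  shows "0 \<le> C i F y" "0 \<le> D i F y" "2 * F y * C i F y \<le> (D i F y)^2"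
proof -
  have q: "quad F" using F by (simp add: rayleigh_def)
  have ray: "F y * (2 * C i F y) \<le> (D i F y)^2" for y
    using F unfolding rayleigh_def D_D[OF q, symmetric] power2_eq_square by blast
  let ?F = "F y" and ?D = "D i F y" and ?C = "C i F y"
  have P: "?F + s * ?D + s^2 * ?C > 0" if "0 \<le> s" for s
    using pos[OF that] by (simp add: quad_shift[OF q])
  have F0: "?F > 0" using P[of 0] by simp
  show C: "0 \<le> ?C"
  proof (rule ccontr)
    assume neg: "\<not> 0 \<le> ?C"
    \<comment> \<open>So far out \<open>?D + s * ?C\<close> is at most \<open>- ?F\<close>, and
      \<open>s \<ge> 1\<close> then makes the value at \<open>s\<close> nonpositive.\<close>
    define s where "s = max 1 ((\<bar>?D\<bar> + ?F) / (- ?C))"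
    have "s \<ge> (\<bar>?D\<bar> + ?F) / (- ?C)" by (simp add: s_def)
    then have "s * (- ?C) \<ge> \<bar>?D\<bar> + ?F" using neg by (subst (asm) pos_divide_le_eq) auto
    then have "?D + s * ?C \<le> - ?F" by linarith
    moreover have s: "s \<ge> 1" by (simp add: s_def)
    ultimately have "s * (?D + s * ?C) \<le> s * (- ?F)" by (intro mult_left_mono) auto
    also have "\<dots> \<le> - ?F" using s F0 by simp
    finally show False using P[of s] s by (simp add: algebra_simps power2_eq_square)
  qed
  show "0 \<le> ?D"
  proof (rule ccontr)
    assume neg: "\<not> 0 \<le> ?D"
    show False
    proof (cases "?C = 0")
      case True
      then show False using P[of "- ?F / ?D"] neg F0 by (simp add: divide_nonneg_neg)
    next
      case False
      define s where "s = - ?D / (2 * ?C)"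
      have s: "0 \<le> s" using neg C unfolding s_def by (intro divide_nonneg_nonneg) auto
      have "D i F (y(i := y i + s)) = 0" using False D_shift[OF q, of i y s] by (simp add: s_def)
      moreover have "C i F (y(i := y i + s)) = ?C"
      proof -
        obtain a b c where "\<And>t. F (y(i := t)) = a + b * t + c * t^2"
          using quadE[OF q] by blast
        from quad_coeffs(2)[where z = y and f = F and i = i, OF this] show ?thesis
          by (metis fun_upd_triv)
      qed
      ultimately have "F (y(i := y i + s)) * (2 * ?C) \<le> 0" using ray[of "y(i := y i + s)"] by simp
      then show False using pos[OF s] C False by (simp add: mult_le_0_iff)
    qed
  qed
  show "2 * ?F * ?C \<le> ?D^2" using ray[of y] by (simp add: algebra_simps)
qed

text \<open>The lag \<open>r = 1/d - d\<close> satisfies \<open>d * r = 1 - d^2\<close>, which makes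
  the coefficients of \<open>D i F x\<close> and of \<open>C i F x\<close> in the two expansions
  around \<open>x\<close> agree at the same time.\<close>

lemma shift_operator_eq:
  fixes F :: "(nat \<Rightarrow> real) \<Rightarrow> real"
  assumes "quad F" "0 < d" "d < 1"
  shows "F (x(i := x i + d)) - C i F (x(i := x i + d))
    = (F x - d^2 * F (x(i := x i - (1/d - d)))) / (1 - d^2)"
proof -
  obtain a b c where abc: "\<And>t. F (x(i := t)) = a + b * t + c * t^2"
    using quadE[OF assms(1)] by blast
  have "C i F (x(i := x i + d)) = C i F x"
    using quad_coeffs(2)[OF abc] by (metis fun_upd_triv)
  moreover have "1 - d^2 \<noteq> 0" using assms by (simp add: power2_eq_1_iff)
  moreover have "d * (1/d - d) = 1 - d^2" using assms by (simp add: field_simps power2_eq_square)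
  then have "(F x + d * D i F x + d^2 * C i F x - C i F x) * (1 - d^2)
      = F x - d^2 * (F x - (1/d - d) * D i F x + (1/d - d)^2 * C i F x)"
    by algebra
  moreover have "F (x(i := x i - (1/d - d))) = F x - (1/d - d) * D i F x + (1/d - d)^2 * C i F x"
    using quad_shift[OF assms(1), of x i "- (1/d - d)"]
    by (simp only: power2_minus minus_mult_left[symmetric] add_uminus_conv_diff)
  ultimately show ?thesis
    by (simp only: quad_shift[OF assms(1)] eq_divide_eq simp_thms if_False if_True)
qed

text \<open>By \<open>shift_operator_eq\<close>, \<open>G\<close> at the raised point combines
  values of \<open>F\<close> at two points at distance \<open>r = 1/d - d\<close>. Positivity holds
  because \<open>F\<close> is no larger at the lower one; the bounds \<open>e\<close> survive
  because the logarithmic derivatives there are at least as large.\<close>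

lemma barrier_step:
  assumes F: "rayleigh F" and i: "i < n" and d: "0 < d" "d < 1"
    and b: "D i F x \<le> b * F x" "b * (1/d - d) < 1"
    and pos: "\<And>y. y \<in> orthant i n x \<Longrightarrow> F y > 0"
  defines "G \<equiv> \<lambda>y. F y - C i F y" and "x' \<equiv> x(i := x i + d)"
  shows "y \<in> orthant (Suc i) n x' \<Longrightarrow> G y > 0"
    and "i \<noteq> j \<Longrightarrow> D j F x \<le> e * F x \<Longrightarrow> D j G x' \<le> e * G x'"
proof -
  have q: "quad F" using F by (simp add: rayleigh_def)
  define r where "r = 1/d - d"
  have d2: "d^2 < 1" using d by (simp add: power_less_one_iff)
  have r: "0 < r" using d d2 by (simp add: r_def field_simps power2_eq_square)
  have x_orthant: "x \<in> orthant i n x" by (simp add: orthant_def)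
  \<comment> \<open>The slope bound and \<open>r * b < 1\<close> keep the affine part positive on
    the way down, and the quadratic term only adds to it. The upper bound needs the curvature
    controlled by the slope.\<close>
  have below: "0 < F (y(i := y i - s)) \<and> F (y(i := y i - s)) \<le> F y"
    if y: "y \<in> orthant i n x" and s: "0 \<le> s" "s \<le> r" for y s
  proof -
    have F0: "F y > 0" using pos y by simp
    have up: "F (y(i := y i + s)) > 0" if "0 \<le> s" for s
      using y that i by (intro pos) (auto simp: orthant_def add_increasing2)
    note der = orthant_derivatives[OF F up]
    have "D i F y / F y \<le> D i F x / F x" by (rule orthant_ratio_decreasing[OF F pos y])
    also have "\<dots> \<le> b" using b(1) pos[OF x_orthant] by (simp add: pos_divide_le_eq)
    finally have Db: "D i F y \<le> b * F y" using F0 by (simp add: pos_divide_le_eq)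
    have b0: "0 \<le> b"
    proof -
      have "0 \<le> b * F y" using Db der(2) by linarith
      then show ?thesis using F0 by (simp add: zero_le_mult_iff)
    qed
    have sb: "s * b < 1"
    proof -
      have "s * b \<le> r * b" using s b0 by (rule_tac mult_right_mono)
      also have "\<dots> < 1" using b(2) by (simp add: r_def mult.commute)
      finally show ?thesis .
    qed
    have eq: "F (y(i := y i - s)) = F y - s * D i F y + s^2 * C i F y"
      using quad_shift[OF q, of y i "-s"] by simp
    have "s * D i F y \<le> s * (b * F y)" using Db s by (intro mult_left_mono)
    also have "\<dots> = (s * b) * F y" by simp
    also have "\<dots> < 1 * F y" using sb F0 by (intro mult_strict_right_mono)
    finally have "F y - s * D i F y > 0" by simp
    moreover have "s^2 * C i F y \<ge> 0" using der(1) by simp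
    ultimately have 1: "F (y(i := y i - s)) > 0" unfolding eq by linarith
    \<comment> \<open>The Rayleigh inequality for \<open>i = j\<close> turns the slope bound into
      \<open>2 * C i F y \<le> b * D i F y\<close>, so the quadratic term cannot outweigh the linear
      one over a distance \<open>s\<close> with \<open>s * b < 1\<close>.\<close>
    have "2 * F y * C i F y \<le> (b * F y) * D i F y"
      using der(3) mult_right_mono[OF Db der(2)] by (simp add: power2_eq_square)
    then have "F y * (2 * C i F y) \<le> F y * (b * D i F y)" by (simp add: algebra_simps)
    then have "2 * C i F y \<le> b * D i F y" using F0 by simp
    then have "s * (2 * C i F y) \<le> s * (b * D i F y)" using s by (intro mult_left_mono)
    also have "\<dots> = (s * b) * D i F y" by simp
    also have "\<dots> \<le> 1 * D i F y" using sb der(2) by (intro mult_right_mono) auto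
    finally have "s * C i F y \<le> D i F y" using der(2) by linarith
    then have "s * (s * C i F y) \<le> s * D i F y" using s by (intro mult_left_mono)
    then have 2: "F (y(i := y i - s)) \<le> F y" unfolding eq by (simp add: power2_eq_square)
    from 1 2 show ?thesis by simp
  qed
  have G_pos: "G y > 0" if y: "y \<in> orthant (Suc i) n x'" for y
  proof -
    \<comment> \<open>Undoing the shift by \<open>d\<close> in coordinate \<open>i\<close> leads
      back to the orthant where \<open>F\<close> is controlled.\<close>
    define y0 where "y0 = y(i := x i)"
    have yi: "y i = x i + d" using y by (simp add: orthant_def x'_def)
    have y0: "y0 \<in> orthant i n x"
      using y i unfolding orthant_def y0_def x'_def
      by (auto simp: less_Suc_eq split: if_splits)
    have y_eq: "y = y0(i := y0 i + d)" using yi by (auto simp: y0_def)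
    have G: "G y = (F y0 - d^2 * F (y0(i := y0 i - r))) / (1 - d^2)"
      unfolding G_def y_eq r_def by (rule shift_operator_eq[OF q d])
    have B: "0 < F (y0(i := y0 i - r))" "F (y0(i := y0 i - r)) \<le> F y0"
      using below[OF y0, of r] r by auto
    have "d^2 * F (y0(i := y0 i - r)) < 1 * F (y0(i := y0 i - r))"
      using d2 B(1) by (rule mult_strict_right_mono)
    then have "d^2 * F (y0(i := y0 i - r)) < F y0" using B(2) by linarith
    then show ?thesis unfolding G using d2 by (intro divide_pos_pos) auto
  qed
  then show "y \<in> orthant (Suc i) n x' \<Longrightarrow> G y > 0" .
  have Gx': "G x' > 0" by (rule G_pos) (simp add: orthant_def)
  show "D j G x' \<le> e * G x'" if ij: "i \<noteq> j" and e: "D j F x \<le> e * F x"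
  proof -
    let ?x = "x(i := x i - r)"
    have F0: "F x > 0" using pos x_orthant by simp
    have Fr: "F ?x > 0" using below[OF x_orthant, of r] r by simp
    \<comment> \<open>The ratio \<open>D j F / F\<close> is at least as large at the lower point, so
      subtracting \<open>d^2\<close> times the values there takes proportionally at least as much
      from the derivative as from the function.\<close>
    have "D j F (?x(i := ?x i + r)) / F (?x(i := ?x i + r)) \<le> D j F ?x / F ?x"
    proof (rule rayleigh_ratio_decreasing[OF F])
      fix s assume "0 \<le> s" "s \<le> r"
      then show "F (?x(i := ?x i + s)) > 0"
        using below[OF x_orthant, of "r - s"] by (simp add: algebra_simps)
    qed (use r in auto)
    then have "D j F x * F ?x \<le> D j F ?x * F x" using F0 Fr by (simp add: divide_simps split: if_splits)
    then have *: "d^2 * (D j F x * F ?x) \<le> d^2 * (D j F ?x * F x)" by (intro mult_left_mono) auto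
    have G: "G x' = (F x - d^2 * F ?x) / (1 - d^2)"
      unfolding G_def x'_def r_def by (rule shift_operator_eq[OF q d])
    have DG: "D j G x' = (D j F x - d^2 * D j F ?x) / (1 - d^2)"
      unfolding G_def x'_def r_def D_diff_C[OF ij] by (rule shift_operator_eq[OF quad_D[OF q] d])
    have "(D j F x - d^2 * D j F ?x) * F x \<le> D j F x * (F x - d^2 * F ?x)"
      using * by (simp add: algebra_simps)
    then have "D j G x' * F x \<le> D j F x * G x'"
      unfolding G DG using d2 by (simp add: divide_right_mono)
    also have "\<dots> \<le> (e * F x) * G x'" using e Gx' by (intro mult_right_mono) auto
    finally have "(D j G x') * F x \<le> (e * G x') * F x" by (simp add: algebra_simps)
    then show ?thesis using F0 by simp
  qed
qed

section \<open>Stability implies the Rayleigh inequality\<close>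

text \<open>All roots \<open>p\<close>, \<open>q\<close> have nonpositive imaginary part, so
  \<open>P = t - p\<close> and \<open>Q = t - q\<close> lie in the upper half plane. There
  \<open>P * Q = 1\<close> is impossible, since inversion maps to the lower half plane, and the
  logarithmic derivative \<open>1/P + 1/Q\<close> has negative imaginary part. The degenerate cases
  have one root or none.\<close>

lemma quadratic_roots_below:
  fixes a b c :: complex
  assumes nz: "\<And>t. Im t > 0 \<Longrightarrow> a + b * t + c * t^2 \<noteq> 0" and t: "Im t > 0"
  shows "a + b * t + c * t^2 - c \<noteq> 0"
    and "Im ((b + 2 * c * t) * cnj (a + b * t + c * t^2)) \<le> 0"
proof -
  have "a + b * t + c * t^2 - c \<noteq> 0 \<and> Im ((b + 2 * c * t) * cnj (a + b * t + c * t^2)) \<le> 0"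
  proof (cases "c = 0")
    case c: True
    show ?thesis
    proof (cases "b = 0")
      case True
      then show ?thesis using nz[OF t] c by simp
    next
      case False
      define p where "p = - a / b"
      have "a + b * p + c * p^2 = 0" using False c by (simp add: p_def)
      then have p: "Im p \<le> 0" using nz[of p] by force
      have "a + b * t = b * (t - p)" using False by (simp add: p_def field_simps)
      then have "b * cnj (a + b * t) = of_real ((cmod b)^2) * cnj (t - p)"
        by (simp only: complex_cnj_mult mult.assoc[symmetric] complex_norm_square)
      then have "Im (b * cnj (a + b * t)) = (cmod b)^2 * (Im p - Im t)" by simp
      also have "\<dots> \<le> 0" using p t by (intro mult_nonneg_nonpos) auto
      finally show ?thesis using c nz[OF t] by simp
    qed
  next
    case c: False
    define r where "r = csqrt (b^2 - 4 * a * c)"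
    define p where "p = (- b + r) / (2 * c)"
    define q where "q = (- b - r) / (2 * c)"
    have r2: "r^2 = b^2 - 4 * a * c" by (simp add: r_def)
    have pq: "c * (p + q) = - b" using c by (simp add: p_def q_def field_simps)
    have "c * (p * q) = (b^2 - r^2) / (4 * c)"
      using c by (simp add: p_def q_def field_simps power2_eq_square)
    then have pq': "c * (p * q) = a" using c by (simp add: r2)
    have fact: "a + b * s + c * s^2 = c * ((s - p) * (s - q))" for s
      using pq pq' by algebra
    have p: "Im p \<le> 0" using nz[of p] fact[of p] by force
    have q: "Im q \<le> 0" using nz[of q] fact[of q] by force
    define P where "P = t - p"
    define Q where "Q = t - q"
    have PQ: "Im P > 0" "Im Q > 0" using p q t by (simp_all add: P_def Q_def)
    have "P * Q \<noteq> 1"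
    proof
      assume "P * Q = 1"
      moreover have "P \<noteq> 0" using PQ by auto
      ultimately have "Q = inverse P" by (simp add: inverse_unique mult.commute)
      then have "Im Q = - Im P / ((Re P)^2 + (Im P)^2)" by simp
      also have "\<dots> \<le> 0" using PQ by (intro divide_nonpos_nonneg) auto
      finally show False using PQ by simp
    qed
    moreover have "a + b * t + c * t^2 - c = c * (P * Q - 1)"
      unfolding fact P_def Q_def by (simp add: algebra_simps)
    ultimately have 1: "a + b * t + c * t^2 - c \<noteq> 0" using c by simp
    have "b + 2 * c * t = c * (P + Q)" using pq unfolding P_def Q_def by algebra
    then have "(b + 2 * c * t) * cnj (a + b * t + c * t^2) = (c * cnj c) * ((P * cnj P) * cnj Q + (Q * cnj Q) * cnj P)"
      unfolding fact P_def[symmetric] Q_def[symmetric] by (simp add: algebra_simps)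
    also have "\<dots> = of_real ((cmod c)^2) * (of_real ((cmod P)^2) * cnj Q + of_real ((cmod Q)^2) * cnj P)"
      by (simp only: complex_norm_square)
    finally have "Im ((b + 2 * c * t) * cnj (a + b * t + c * t^2))
        = - ((cmod c)^2 * ((cmod P)^2 * Im Q + (cmod Q)^2 * Im P))"
      by (simp add: algebra_simps del: of_real_power)
    also have "\<dots> \<le> 0" using PQ by (simp add: mult_nonneg_nonneg)
    finally show ?thesis using 1 by simp
  qed
  then show "a + b * t + c * t^2 - c \<noteq> 0"
    and "Im ((b + 2 * c * t) * cnj (a + b * t + c * t^2)) \<le> 0" by blast+
qed

section \<open>Real stability and its preservation\<close>

definition stable :: "((nat \<Rightarrow> complex) \<Rightarrow> complex) \<Rightarrow> bool" where
  "stable f \<longleftrightarrow> (\<forall>z. (\<forall>i. Im (z i) > 0) \<longrightarrow> f z \<noteq> 0)"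

text \<open>Moving all variables by the same amount suffices to pass from the open upper half plane
  to its boundary.\<close>

definition diag_continuous :: "((nat \<Rightarrow> complex) \<Rightarrow> complex) \<Rightarrow> bool" where
  "diag_continuous f \<longleftrightarrow> (\<forall>z. continuous_on UNIV (\<lambda>h. f (\<lambda>k. z k + h)))"

definition real_on_reals :: "((nat \<Rightarrow> complex) \<Rightarrow> complex) \<Rightarrow> bool" where
  "real_on_reals f \<longleftrightarrow> (\<forall>x::nat \<Rightarrow> real. f (\<lambda>k. of_real (x k)) \<in> \<real>)"

definition restrict_real :: "((nat \<Rightarrow> complex) \<Rightarrow> complex) \<Rightarrow> (nat \<Rightarrow> real) \<Rightarrow> real" where
  "restrict_real f x = Re (f (\<lambda>k. of_real (x k)))"

lemma of_real_fun_upd: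
  "(\<lambda>k. of_real ((x(i := s)) k)) = (\<lambda>k. of_real (x k))(i := of_real s)"
  by auto

lemma restrict_real_shift:
  "restrict_real f (x(i := s)) = Re (f ((\<lambda>k. of_real (x k))(i := of_real s)))"
  by (simp add: restrict_real_def of_real_fun_upd del: fun_upd_apply)

lemma D_restrict_real: "D i (restrict_real f) = restrict_real (D i f)"
  by (rule ext) (simp add: D_def restrict_real_shift restrict_real_def[of "D i f" for f i])

lemma C_restrict_real: "C i (restrict_real f) = restrict_real (C i f)"
  by (rule ext) (simp add: C_def restrict_real_shift restrict_real_def[of "C i f" for f i] restrict_real_def[of f])

lemma real_on_realsD:
  assumes "real_on_reals f"
  shows "f (\<lambda>k. of_real (x k)) = of_real (restrict_real f x)"
  using assms unfolding real_on_reals_def restrict_real_def by (metis of_real_Re)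

lemma real_on_reals_upd:
  assumes "real_on_reals f"
  shows "f ((\<lambda>k. of_real (x k))(i := of_real s)) \<in> \<real>"
  using assms unfolding real_on_reals_def of_real_fun_upd[symmetric] by blast

lemma real_on_reals_D: "real_on_reals f \<Longrightarrow> real_on_reals (D i f)"
  using real_on_reals_upd[of f _ i "_ + 1"] real_on_reals_upd[of f _ i "_ - 1"]
  by (subst real_on_reals_def) (simp add: D_def)

lemma real_on_reals_C: "real_on_reals f \<Longrightarrow> real_on_reals (C i f)"
  using real_on_reals_upd[of f _ i "_ + 1"] real_on_reals_upd[of f _ i "_ - 1"]
  by (subst real_on_reals_def) (simp add: C_def real_on_realsD)

lemma diag_continuous_upd:
  assumes "diag_continuous f"
  shows "continuous_on UNIV (\<lambda>h. f ((\<lambda>k. z k + h)(i := z i + h + s)))"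
proof -
  have "(\<lambda>k. z k + h)(i := z i + h + s) = (\<lambda>k. (z(i := z i + s)) k + h)" for h
    by (auto simp: fun_eq_iff)
  then show ?thesis using assms unfolding diag_continuous_def by simp
qed

lemma diag_continuous_D:
  assumes "diag_continuous f" shows "diag_continuous (D i f)"
  unfolding diag_continuous_def D_def
  using diag_continuous_upd[OF assms, of _ i 1] diag_continuous_upd[OF assms, of _ i "-1"]
  by (auto intro!: continuous_intros)

lemma diag_continuous_C:
  assumes "diag_continuous f" shows "diag_continuous (C i f)"
  unfolding diag_continuous_def C_def
  using diag_continuous_upd[OF assms, of _ i 1] diag_continuous_upd[OF assms, of _ i "-1"]
    assms[unfolded diag_continuous_def]
  by (auto intro!: continuous_intros)

definition real_stable :: "((nat \<Rightarrow> complex) \<Rightarrow> complex) \<Rightarrow> bool" where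
  "real_stable f \<longleftrightarrow> quad f \<and> stable f \<and> diag_continuous f \<and> real_on_reals f"

lemma stable_quadratic:
  assumes "quad f" "stable f" "\<And>k. Im (z k) > 0"
  shows "f z - C i f z \<noteq> 0" "Im (D i f z * cnj (f z)) \<le> 0"
proof -
  obtain a b c where abc: "\<And>t. f (z(i := t)) = a + b * t + c * t^2"
    using quadE[OF assms(1)] by blast
  have nz: "a + b * t + c * t^2 \<noteq> 0" if "Im t > 0" for t
    unfolding abc[symmetric] using assms(2,3) that by (simp add: stable_def)
  have "f z = a + b * z i + c * (z i)^2" "D i f z = b + 2 * c * z i" "C i f z = c"
    using abc[of "z i"] quad_coeffs[OF abc, of "z i"] by simp_all
  then show "f z - C i f z \<noteq> 0" "Im (D i f z * cnj (f z)) \<le> 0"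
    using quadratic_roots_below[OF nz assms(3)] by metis+
qed

text \<open>Freezing all variables but \<open>i\<close> reduces stability to a fact in one variable:
  subtracting the leading coefficient from a quadratic without zeros in the upper half plane creates
  none there.\<close>

lemma real_stable_operator:
  assumes "real_stable f"
  shows "real_stable (\<lambda>z. f z - C i f z)"
proof -
  have f: "quad f" "stable f" "diag_continuous f" "real_on_reals f"
    using assms by (auto simp: real_stable_def)
  have "quad (\<lambda>z. f z - C i f z)"
    using quad_lincomb[OF f(1) quad_C[OF f(1)], where r = 1 and s = "-1"] by simp
  moreover have "stable (\<lambda>z. f z - C i f z)"
    using stable_quadratic(1)[OF f(1,2)] by (subst stable_def) blast
  moreover have "diag_continuous (\<lambda>z. f z - C i f z)"
    using f(3) diag_continuous_C[OF f(3)] unfolding diag_continuous_def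
    by (auto intro!: continuous_intros)
  moreover have "real_on_reals (\<lambda>z. f z - C i f z)"
    using f(4) real_on_reals_C[OF f(4)] unfolding real_on_reals_def by auto
  ultimately show ?thesis by (simp add: real_stable_def)
qed

lemma nonpos_if_quadratic_perturbation:
  fixes a b :: real
  assumes "\<And>e. e > 0 \<Longrightarrow> a + e^2 * b \<le> 0"
  shows "a \<le> 0"
proof (rule tendsto_upperbound)
  show "((\<lambda>e. a + e^2 * b) \<longlongrightarrow> a) (at_right 0)"
    by (auto intro!: tendsto_eq_intros)
  show "\<forall>\<^sub>F e in at_right 0. a + e^2 * b \<le> 0"
    using assms by (auto simp: eventually_at_filter)
qed simp

text \<open>The imaginary part of \<open>D j f\<close> times the conjugate of \<open>f\<close> is
  nonpositive on the upper half plane, hence on its closure. At a real point displaced by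
  \<open>e\<close> times the imaginary unit in the variable \<open>i\<close>, its coefficient of
  first order in \<open>e\<close> is \<open>F * D i (D j F) - D i F * D j F\<close>.\<close>

lemma real_stable_imp_rayleigh:
  assumes "real_stable f"
  shows "rayleigh (restrict_real f)"
proof -
  have f: "quad f" "stable f" "diag_continuous f" "real_on_reals f"
    using assms by (auto simp: real_stable_def)
  let ?F = "restrict_real f"
  have "quad ?F"
    unfolding quad_def
  proof (intro allI)
    fix i and x :: "nat \<Rightarrow> real"
    let ?z = "\<lambda>k. complex_of_real (x k)"
    obtain a b c where abc: "\<And>t. f (?z(i := t)) = a + b * t + c * t^2"
      using quadE[OF f(1)] by blast
    have "\<forall>t. ?F (x(i := t)) = Re a + Re b * t + Re c * t^2"
      by (simp add: restrict_real_shift abc flip: of_real_power)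
    then show "\<exists>a b c. \<forall>t. ?F (x(i := t)) = a + b * t + c * t^2" by blast
  qed
  moreover have "?F x * D i (D j ?F) x \<le> D i ?F x * D j ?F x" for i j x
  proof -
    define z where "z = (\<lambda>k. complex_of_real (x k))"
    let ?g = "D j f"
    \<comment> \<open>A boundary point is approached by adding the same small positive imaginary
      number to all coordinates.\<close>
    have lim: "Im (?g w * cnj (f w)) \<le> 0" if w: "\<And>k. Im (w k) \<ge> 0" for w
    proof -
      define h where "h e = Im (?g (\<lambda>k. w k + \<i> * of_real e) * cnj (f (\<lambda>k. w k + \<i> * of_real e)))" for e
      have cf: "continuous_on UNIV (\<lambda>e. u (\<lambda>k. w k + \<i> * complex_of_real e))"
        if "diag_continuous u" for u
        by (rule continuous_on_compose2[of UNIV "\<lambda>h. u (\<lambda>k. w k + h)"])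
          (use that in \<open>auto simp: diag_continuous_def intro!: continuous_intros\<close>)
      have "continuous_on UNIV h"
        unfolding h_def by (intro continuous_intros cf f(3) diag_continuous_D)
      then have "isCont h 0" by (simp add: continuous_on_eq_continuous_at)
      then have "(h \<longlongrightarrow> h 0) (at_right 0)"
        unfolding isCont_def by (rule filterlim_mono) (auto simp: at_within_le_at)
      moreover have "\<forall>\<^sub>F e in at_right 0. h e \<le> 0"
        unfolding h_def eventually_at_filter
        by (intro always_eventually allI impI stable_quadratic(2)[OF f(1,2)])
          (use w in \<open>simp add: add_nonneg_pos\<close>)
      ultimately have "h 0 \<le> 0" by (rule tendsto_upperbound) simp
      then show ?thesis by (simp add: h_def)
    qed
    have re: "u z = of_real (restrict_real u x)" if "real_on_reals u" for u
      unfolding z_def using that by (rule real_on_realsD)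
    define F0 F1 F2 G0 G1 G2 where "F0 = ?F x" and "F1 = D i ?F x" and "F2 = C i ?F x"
      and "G0 = D j ?F x" and "G1 = D i (D j ?F) x" and "G2 = C i (D j ?F) x"
    have vals: "f z = of_real F0" "D i f z = of_real F1" "C i f z = of_real F2"
      "?g z = of_real G0" "D i ?g z = of_real G1" "C i ?g z = of_real G2"
      by (simp_all add: F0_def F1_def F2_def G0_def G1_def G2_def D_restrict_real C_restrict_real
          re f(4) real_on_reals_D real_on_reals_C)
    have "F0 * G1 - F1 * G0 \<le> 0"
    proof (rule nonpos_if_quadratic_perturbation)
      fix e :: real assume e: "e > 0"
      \<comment> \<open>Only the variable \<open>i\<close> leaves the real axis; the others stay
        real, which is why \<open>lim\<close> has to cover the boundary.\<close>
      define w where "w = z(i := z i + \<i> * of_real e)"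
      have "Im (?g w * cnj (f w)) \<le> 0" using e by (intro lim) (simp add: w_def z_def)
      moreover have "f w = Complex (F0 - e^2 * F2) (e * F1)" "?g w = Complex (G0 - e^2 * G2) (e * G1)"
        unfolding w_def quad_shift[OF f(1)] quad_shift[OF quad_D[OF f(1)]] vals
        by (simp_all add: complex_eq_iff power2_eq_square)
      ultimately have "e * (G1 * (F0 - e^2 * F2)) - e * (F1 * (G0 - e^2 * G2)) \<le> 0"
        by (simp add: algebra_simps)
      then have "e * (F0 * G1 - F1 * G0 + e^2 * (F1 * G2 - G1 * F2)) \<le> e * 0"
        by (simp add: algebra_simps)
      then show "F0 * G1 - F1 * G0 + e^2 * (F1 * G2 - G1 * F2) \<le> 0" using e by (simp only: mult_le_cancel_left_pos)
    qed
    then show ?thesis by (simp add: F0_def G1_def F1_def G0_def)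
  qed
  ultimately show ?thesis by (simp add: rayleigh_def)
qed

section \<open>Applying all the operators in turn\<close>

lemma op_i_eq:
  assumes "quad f"
  shows "op_i i f = (\<lambda>z. f z - C i f z)"
proof
  fix z
  obtain a b c where abc: "\<And>t. f (z(i := t)) = a + b * t + c * t^2"
    using quadE[OF assms] by blast
  have "deriv (\<lambda>t. f (z(i := t))) = (\<lambda>t. b + 2 * c * t)"
    unfolding abc by (rule ext, rule DERIV_imp_deriv) (auto intro!: derivative_eq_intros)
  moreover have "deriv (\<lambda>t. b + 2 * c * t) (z i) = 2 * c"
    by (rule DERIV_imp_deriv) (auto intro!: derivative_eq_intros)
  moreover have "C i f z = c" using quad_coeffs(2)[OF abc, of "z i"] by simp
  ultimately show "op_i i f z = f z - C i f z" by (simp add: op_i_def)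
qed

lemma real_stable_ops: "real_stable f \<Longrightarrow> real_stable (ops k f)"
  by (induction k) (simp_all add: op_i_eq real_stable_operator real_stable_def[THEN iffD1])

text \<open>Induction on the number \<open>k\<close> of applied operators. Each one moves its
  coordinate from \<open>- d k\<close> to 0; positivity on the remaining orthant and the bounds
  \<open>b j\<close> for the coordinates still to come are carried along, until the point is
  0.\<close>

lemma ops_nonzero:
  assumes f: "real_stable f"
    and d: "\<And>i. i < n \<Longrightarrow> 0 < d i \<and> d i < 1"
    and b: "\<And>i. i < n \<Longrightarrow> b i * (1 / d i - d i) < 1"
    and x: "x = (\<lambda>i. if i < n then - d i else 0)"
    and pos: "\<And>y. y \<in> orthant 0 n x \<Longrightarrow> restrict_real f y > 0"
    and der: "\<And>j. j < n \<Longrightarrow> D j (restrict_real f) x \<le> b j * restrict_real f x"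
  shows "ops n f (\<lambda>_. 0) \<noteq> 0"
proof -
  define X where "X k = (\<lambda>i. if k \<le> i then x i else 0)" for k
  let ?F = "\<lambda>k. restrict_real (ops k f)"
  have "(\<forall>y \<in> orthant k n (X k). ?F k y > 0) \<and>
      (\<forall>j. k \<le> j \<and> j < n \<longrightarrow> D j (?F k) (X k) \<le> b j * ?F k (X k))" if "k \<le> n" for k
    using that
  proof (induction k)
    case 0
    then show ?case using pos der by (simp add: X_def)
  next
    case (Suc k)
    then have k: "k < n" by simp
    have st: "real_stable (ops k f)" by (rule real_stable_ops[OF f])
    have F: "?F (Suc k) = (\<lambda>y. ?F k y - C k (?F k) y)"
      using st unfolding real_stable_def
      by (auto simp: op_i_eq C_restrict_real) (auto simp: restrict_real_def fun_eq_iff)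
    have X: "X (Suc k) = (X k)(k := X k k + d k)"
      using k by (auto simp: X_def x fun_eq_iff)
    have IH: "\<And>y. y \<in> orthant k n (X k) \<Longrightarrow> ?F k y > 0"
      "\<And>j. k \<le> j \<Longrightarrow> j < n \<Longrightarrow> D j (?F k) (X k) \<le> b j * ?F k (X k)"
      using Suc k by auto
    note step = barrier_step[OF real_stable_imp_rayleigh[OF st] k _ _ IH(2)[OF order_refl k] b[OF k] IH(1)]
    show ?case
      unfolding F X using step d[OF k] IH(2) by (auto simp: Suc_le_eq simp del: fun_upd_apply)
  qed
  from this[of n] have "?F n (X n) > 0" by (auto simp: orthant_def)
  moreover have "X n = (\<lambda>_. 0)" by (auto simp: X_def x fun_eq_iff)
  ultimately show ?thesis by (auto simp: restrict_real_def)
qed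

section \<open>The determinantal polynomial\<close>

definition ip :: "complex^'d \<Rightarrow> complex^'d \<Rightarrow> complex" where
  "ip v w = (\<Sum>i\<in>UNIV. cnj (v $ i) * w $ i)"

definition nsq :: "complex^'d \<Rightarrow> real" where
  "nsq w = (\<Sum>i\<in>UNIV. (cmod (w $ i))^2)"

lemma nsq_nonneg: "0 \<le> nsq w"
  by (simp add: nsq_def sum_nonneg)

lemma nsq_eq_0: "nsq w = 0 \<longleftrightarrow> w = 0"
  by (simp add: nsq_def sum_nonneg_eq_0_iff vec_eq_iff)

lemma nsq_pos: "w \<noteq> 0 \<Longrightarrow> 0 < nsq w"
  using nsq_nonneg[of w] nsq_eq_0[of w] by linarith

lemma ip_self: "ip w w = of_real (nsq w)"
  by (simp add: ip_def nsq_def complex_norm_square mult.commute del: of_real_power)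

lemma ip_Cauchy_Schwarz: "(cmod (ip v w))^2 \<le> nsq v * nsq w"
proof -
  have "cmod (ip v w) \<le> (\<Sum>i\<in>UNIV. cmod (v $ i) * cmod (w $ i))"
    unfolding ip_def by (rule order_trans[OF norm_sum]) (simp add: norm_mult)
  then have "(cmod (ip v w))^2 \<le> (\<Sum>i\<in>UNIV. cmod (v $ i) * cmod (w $ i))^2"
    by (rule power_mono) simp
  also have "\<dots> \<le> nsq v * nsq w"
    unfolding nsq_def by (rule Cauchy_Schwarz_ineq_sum)
  finally show ?thesis .
qed

lemma qform_add: "qform (A + B) w = qform A w + qform B w"
  by (simp add: qform_def matrix_vector_mult_add_rdistrib distrib_left sum.distrib)

lemma qform_diff: "qform (A - B) w = qform A w - qform B w"
  using qform_add[of "A - B" B w] by simp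

lemma qform_sum: "qform (\<Sum>i\<in>S. A i) w = (\<Sum>i\<in>S. qform (A i) w)"
  by (induction S rule: infinite_finite_induct) (simp_all add: qform_add, simp_all add: qform_def)

lemma qform_scaleM: "qform (scaleM c A) w = c * qform A w"
  by (simp add: qform_def scaleM_def matrix_vector_mult_def sum_distrib_left algebra_simps)

lemma qform_mat: "qform (mat x) w = x * of_real (nsq w)"
proof -
  have "(mat x *v w) $ i = x * w $ i" for i
    by (simp add: matrix_vector_mult_def mat_def if_distrib[where f = "\<lambda>c. c * _"] cong: if_cong)
  then show ?thesis
    unfolding qform_def ip_self[symmetric] ip_def by (simp add: sum_distrib_left algebra_simps)
qed

lemma outer_mult_vec: "outer v *v w = (\<chi> i. v $ i * ip v w)"
  by (simp add: vec_eq_iff matrix_vector_mult_def outer_def ip_def sum_distrib_left mult.assoc)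

lemma qform_outer: "qform (outer v) w = of_real ((cmod (ip v w))^2)"
proof -
  have "qform (outer v) w = (\<Sum>i\<in>UNIV. cnj (w $ i) * v $ i) * ip v w"
    by (simp add: qform_def outer_mult_vec sum_distrib_right mult.assoc)
  also have "(\<Sum>i\<in>UNIV. cnj (w $ i) * v $ i) = cnj (ip v w)"
    by (simp add: ip_def mult.commute)
  finally show ?thesis by (simp add: complex_norm_square mult.commute del: of_real_power)
qed

lemma outer_mult_outer: "outer v ** outer v = scaleM (of_real (nsq v)) (outer v)"
proof -
  have "(outer v ** outer v) $ i $ j = ip v v * (v $ i * cnj (v $ j))" for i j
    by (simp add: matrix_matrix_mult_def outer_def ip_def sum_distrib_left mult_ac)
  then show ?thesis by (simp add: vec_eq_iff scaleM_def outer_def ip_self)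
qed

section \<open>Nonvanishing, rank one updates and reality of determinants\<close>

lemma det_nonzero_if_qform:
  assumes "\<And>w. w \<noteq> 0 \<Longrightarrow> qform A w \<noteq> 0"
  shows "det A \<noteq> 0"
proof -
  have "w = 0" if "A *v w = 0" for w
    using assms[of w] that by (auto simp: qform_def)
  then have "\<exists>B. B ** A = mat 1" by (simp add: matrix_left_invertible_ker)
  then obtain B where "B ** A = mat 1" by blast
  then have "det B * det A = 1" using det_mul[of B A] by simp
  then show ?thesis by auto
qed

text \<open>Row operations move the rank one perturbation into a single row.\<close>

lemma det_add_outer:
  fixes M :: "complex^'d^'d"
  obtains a b where "\<And>s. det (M + scaleM s (outer v)) = a + b * s"
proof (cases "v = 0")
  case True
  then have "M + scaleM s (outer v) = M" for s
    by (simp add: vec_eq_iff scaleM_def outer_def)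
  then show ?thesis using that[of "det M" 0] by simp
next
  case False
  then obtain k where k: "v $ k \<noteq> 0" by (auto simp: vec_eq_iff)
  define c where "c i = (if i = k then 0 else v $ i / v $ k)" for i
  define E :: "complex^'d^'d" where "E = (\<chi> i l. (if i = l then 1 else 0) - (if l = k then c i else 0))"
  define N where "N = E ** M"
  have E: "(E ** A) $ i $ j = A $ i $ j - c i * A $ k $ j" for A :: "complex^'d^'d" and i j
    by (simp add: E_def matrix_matrix_mult_def left_diff_distrib sum_subtractf
        if_distrib[where f = "\<lambda>c. c * _"] cong: if_cong)
  \<comment> \<open>\<open>E'\<close> adds the subtracted multiples of row \<open>k\<close> back, so
    \<open>E\<close> is invertible and its determinant can be divided out.\<close>
  define E' :: "complex^'d^'d" where "E' = (\<chi> i l. (if i = l then 1 else 0) + (if l = k then c i else 0))"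
  have "E ** E' = mat 1"
    by (auto simp: vec_eq_iff E E'_def mat_def c_def)
  then have "det E * det E' = 1" using det_mul[of E E'] by simp
  then have detE: "det E \<noteq> 0" by auto
  define u where "u = (\<chi> j. v $ k * cnj (v $ j))"
  have "det E * det (M + scaleM s (outer v)) = det N + s * det (\<chi> i. if i = k then u else N $ i)" for s
  proof -
    have c: "c i * v $ k = (if i = k then 0 else v $ i)" for i
      using k by (simp add: c_def)
    have "(E ** (M + scaleM s (outer v))) $ i $ j
        = N $ i $ j + s * cnj (v $ j) * (v $ i - c i * v $ k)" for i j
      by (simp add: E N_def scaleM_def outer_def algebra_simps)
    then have "E ** (M + scaleM s (outer v)) = (\<chi> i. if i = k then N $ k + s *s u else N $ i)"
      by (simp add: vec_eq_iff u_def c)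
    then have "det E * det (M + scaleM s (outer v)) = det (\<chi> i. if i = k then N $ k + s *s u else N $ i)"
      using det_mul[of E "M + scaleM s (outer v)"] by simp
    also have "\<dots> = det (\<chi> i. if i = k then N $ k else N $ i) + s * det (\<chi> i. if i = k then u else N $ i)"
      using det_row_add[of k "\<lambda>_. N $ k" "\<lambda>_. s *s u" "\<lambda>i. N $ i"]
        det_row_mul[of k s "\<lambda>_. u" "\<lambda>i. N $ i"] by simp
    also have "(\<chi> i. if i = k then N $ k else N $ i) = N" by (simp add: vec_eq_iff)
    finally show ?thesis .
  qed
  then have "det (M + scaleM s (outer v)) = det N / det E + det (\<chi> i. if i = k then u else N $ i) / det E * s" for s
    using detE by (simp add: field_simps)
  then show ?thesis by (rule that)
qed

lemma det_hermitian_real: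
  assumes "\<And>i j. A $ i $ j = cnj (A $ j $ i)"
  shows "det A \<in> \<real>"
proof -
  have "cnj (det A) = det (\<chi> i j. cnj (A $ i $ j))"
    by (simp add: det_def)
  also have "(\<chi> i j. cnj (A $ i $ j)) = transpose A"
    by (simp add: vec_eq_iff transpose_def flip: assms)
  finally have "cnj (det A) = det A" by (simp only: det_transpose)
  then show ?thesis by (simp only: Reals_cnj_iff)
qed

section \<open>The matrix pencil at a fixed real number beyond 3\<close>

text \<open>\<open>bound\<close> is the Loewner hypothesis tested on \<open>w\<close>, since the
  square of \<open>outer v\<close> is \<open>nsq v\<close> times \<open>outer v\<close>;
  \<open>x\<close> plays the hypothetical root to be refuted.\<close>

locale rank_one_family =
  fixes n :: nat and \<tau> :: "nat \<Rightarrow> real" and v :: "nat \<Rightarrow> complex^'d" and x :: real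
  assumes tau_pos: "i < n \<Longrightarrow> \<tau> i > 0"
    and bound: "(\<Sum>i<n. (\<tau> i)^2 * nsq (v i) * (cmod (ip (v i) w))^2) \<le> nsq w"
    and x: "x > 3"
begin

definition M :: "(nat \<Rightarrow> complex) \<Rightarrow> complex^'d^'d" where
  "M z = mat (of_real x) + (\<Sum>i<n. scaleM (z i * of_real (\<tau> i)) (outer (v i)))"

lemma qform_M:
  "qform (M z) w = of_real (x * nsq w) + (\<Sum>i<n. z i * of_real (\<tau> i * (cmod (ip (v i) w))^2))"
  by (simp add: M_def qform_add qform_sum qform_mat qform_scaleM qform_outer mult.assoc)

lemma M_upd:
  assumes "j < n"
  shows "M (z(j := t)) = M (z(j := 0)) + scaleM (t * of_real (\<tau> j)) (outer (v j))"
proof -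
  have "M (z(j := t)) = mat (of_real x) + (scaleM (t * of_real (\<tau> j)) (outer (v j)) +
      (\<Sum>i\<in>{..<n} - {j}. scaleM (z i * of_real (\<tau> i)) (outer (v i))))" for t
    unfolding M_def using assms by (subst sum.remove[of _ j]) auto
  moreover have "scaleM (0 * of_real (\<tau> j)) (outer (v j)) = 0"
    by (simp add: scaleM_def vec_eq_iff)
  ultimately show ?thesis by (simp add: algebra_simps)
qed

text \<open>Each variable multiplies a rank one matrix, and variables from \<open>n\<close> on do
  not occur in \<open>M\<close>.\<close>

lemma det_M_upd:
  obtains a b where "\<And>t. det (M (z(j := t))) = a + b * t"
proof (cases "j < n")
  case True
  obtain a b where "\<And>s. det (M (z(j := 0)) + scaleM s (outer (v j))) = a + b * s"
    using det_add_outer by blast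
  then have "det (M (z(j := t))) = a + (b * of_real (\<tau> j)) * t" for t
    by (subst M_upd[OF True]) simp
  then show ?thesis by (rule that)
next
  case False
  then have "M (z(j := t)) = M z" for t by (auto simp: M_def intro!: sum.cong)
  then show ?thesis using that[of "det (M z)" 0] by simp
qed

lemma det_M_real: "det (M (\<lambda>k. of_real (y k))) \<in> \<real>"
  by (rule det_hermitian_real) (auto simp: M_def mat_def scaleM_def outer_def mult_ac)

lemma continuous_on_M: "continuous_on UNIV (\<lambda>h. M (\<lambda>k. z k + h) $ i $ j)"
proof -
  have eq: "M z $ i $ j = mat (of_real x) $ i $ j + (\<Sum>k<n. z k * (of_real (\<tau> k) * outer (v k) $ i $ j))" for z
    by (simp add: M_def scaleM_def mult.assoc)
  show ?thesis unfolding eq by (intro continuous_intros)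
qed

text \<open>The square of an affine function is quadratic. For stability, a zero of the quadratic
  form has vanishing imaginary part, a sum of nonnegative terms; so every rank one term vanishes and
  only \<open>x * nsq w > 0\<close> is left.\<close>

lemma real_stable_det_M: "real_stable (\<lambda>z. (det (M z))^2)"
proof -
  have "quad (\<lambda>z. (det (M z))^2)"
    unfolding quad_def
  proof (intro allI)
    fix i z
    obtain a b where "\<And>t. det (M (z(i := t))) = a + b * t" using det_M_upd by blast
    then have "\<forall>t. (det (M (z(i := t))))^2 = a^2 + (2*a*b) * t + b^2 * t^2"
      by (simp add: power2_eq_square algebra_simps)
    then show "\<exists>a b c. \<forall>t. (det (M (z(i := t))))^2 = a + b * t + c * t^2" by blast
  qed
  moreover have "stable (\<lambda>z. (det (M z))^2)"
    unfolding stable_def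
  proof (intro allI impI)
    fix z :: "nat \<Rightarrow> complex" assume z: "\<forall>i. Im (z i) > 0"
    have "qform (M z) w \<noteq> 0" if w: "w \<noteq> 0" for w
    proof
      assume 0: "qform (M z) w = 0"
      have nn: "0 \<le> Im (z i) * (\<tau> i * (cmod (ip (v i) w))^2)" if "i < n" for i
        using z tau_pos[OF that] by (simp add: less_imp_le)
      have "(\<Sum>i<n. Im (z i) * (\<tau> i * (cmod (ip (v i) w))^2)) = 0"
        using arg_cong[OF 0[unfolded qform_M], of Im] by (simp add: Im_sum del: of_real_mult of_real_power)
      then have "\<forall>i\<in>{..<n}. Im (z i) * (\<tau> i * (cmod (ip (v i) w))^2) = 0"
        using nn by (subst (asm) sum_nonneg_eq_0_iff) auto
      then have "\<tau> i * (cmod (ip (v i) w))^2 = 0" if "i < n" for i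
        using z that by (metis lessThan_iff less_irrefl mult_eq_0_iff)
      then have "(\<Sum>i<n. z i * of_real (\<tau> i * (cmod (ip (v i) w))^2)) = 0"
        by (intro sum.neutral) (simp del: mult_eq_0_iff of_real_mult of_real_power)
      then have "qform (M z) w = of_real (x * nsq w)"
        unfolding qform_M by (simp del: of_real_mult of_real_power)
      then show False using 0 x nsq_pos[OF w] by simp
    qed
    then show "(det (M z))^2 \<noteq> 0" using det_nonzero_if_qform by auto
  qed
  moreover have "diag_continuous (\<lambda>z. (det (M z))^2)"
    unfolding diag_continuous_def det_def
    by (intro allI continuous_intros continuous_on_M)
  moreover have "real_on_reals (\<lambda>z. (det (M z))^2)"
    unfolding real_on_reals_def using det_M_real by auto
  ultimately show ?thesis by (simp add: real_stable_def)
qed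

text \<open>Test \<open>bound\<close> at \<open>w = v i\<close> and keep only the summand
  \<open>i\<close>. The estimate later puts the shifts \<open>d i\<close> below 1.\<close>

lemma nsq_le_1:
  assumes "i < n"
  shows "\<tau> i * nsq (v i) \<le> 1"
proof (cases "v i = 0")
  case True
  then show ?thesis by (simp add: nsq_def)
next
  case False
  have "(\<tau> i)^2 * nsq (v i) * (cmod (ip (v i) (v i)))^2
      \<le> (\<Sum>k<n. (\<tau> k)^2 * nsq (v k) * (cmod (ip (v k) (v i)))^2)"
    using assms nsq_nonneg by (intro member_le_sum) (auto intro!: mult_nonneg_nonneg)
  also have "\<dots> \<le> nsq (v i)" by (rule bound)
  finally have "(\<tau> i * nsq (v i))^2 * nsq (v i) \<le> 1 * nsq (v i)"
    by (simp add: ip_self power2_eq_square algebra_simps)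
  then have "(\<tau> i * nsq (v i))^2 \<le> 1" using nsq_pos[OF False] by (simp only: mult_le_cancel_right_pos)
  then show ?thesis by (simp add: abs_square_le_1)
qed

lemma ops_det_M_nonzero: "ops n (\<lambda>z. (det (M z))^2) (\<lambda>_. 0) \<noteq> 0"
proof -
  obtain t where t: "0 < t" "t < 1" "t * (x - t) > 2"
  proof -
    \<comment> \<open>At \<open>t = 1\<close> the product \<open>t * (x - t)\<close> is
      \<open>x - 1 > 2\<close>, so a value slightly below 1 works. From
      \<open>3 * e \<le> x - 3\<close> the second factor is at least \<open>2 + 4 * e\<close>, which
      outweighs the loss in the first.\<close>
    define e where "e = min (1/4) ((x - 3) / 3)"
    have e: "0 < e" "e \<le> 1/4" "3 * e \<le> x - 3" using x by (auto simp: e_def min_def field_simps)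
    have "(1 - e) * (x - (1 - e)) \<ge> (1 - e) * (2 + 4 * e)"
      using e by (intro mult_left_mono) auto
    moreover have "(1 - e) * (2 + 4 * e) = 2 + 2 * e * (1 - 2 * e)" by (simp add: algebra_simps)
    moreover have "2 * e * (1 - 2 * e) > 0" using e by (intro mult_pos_pos) auto
    ultimately have "(1 - e) * (x - (1 - e)) > 2" by linarith
    then show ?thesis using that[of "1 - e"] e by simp
  qed
  define s where "s i = \<tau> i * nsq (v i)" for i
  \<comment> \<open>For \<open>v i = 0\<close> the bound \<open>b i\<close> is 0 and any shift
    strictly between 0 and 1 serves; \<open>1/2\<close> is one.\<close>
  define d where "d i = (if v i = 0 then 1/2 else t * s i)" for i
  define b where "b i = 2 * s i / (x - t)" for i
  define X where "X = (\<lambda>i. if i < n then - d i else 0)"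
  define f where "f = (\<lambda>z. (det (M z))^2)"
  have xt: "x - t > 0" using x t by simp
  have s: "0 < s i" "s i \<le> 1" if "i < n" "v i \<noteq> 0" for i
    using nsq_le_1[OF that(1)] tau_pos[OF that(1)] nsq_pos[OF that(2)] by (simp_all add: s_def)
  \<comment> \<open>For \<open>r = 0\<close> this is the bound of the matrix below by
    \<open>(x - t) I\<close> on the orthant: the shifts \<open>d i\<close> cost at most
    \<open>t * nsq w\<close> by \<open>bound\<close>. The extra \<open>r\<close> probes the variable
    \<open>j\<close> for the derivative estimate.\<close>
  have q: "(x - t) * nsq w + r * (\<tau> j * (cmod (ip (v j) w))^2)
      \<le> Re (qform (M (\<lambda>k. of_real ((y(j := y j + r)) k))) w)"
    if y: "y \<in> orthant 0 n X" and j: "j < n" for w y r j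
  proof -
    let ?p = "\<lambda>i. \<tau> i * (cmod (ip (v i) w))^2"
    have "d i * ?p i \<le> t * ((\<tau> i)^2 * nsq (v i) * (cmod (ip (v i) w))^2)" for i
      by (simp add: d_def s_def power2_eq_square ip_def nsq_def)
    then have "(\<Sum>i<n. d i * ?p i) \<le> t * (\<Sum>i<n. (\<tau> i)^2 * nsq (v i) * (cmod (ip (v i) w))^2)"
      unfolding sum_distrib_left by (rule sum_mono)
    also have "\<dots> \<le> t * nsq w" using bound t by (intro mult_left_mono) auto
    finally have 1: "(\<Sum>i<n. d i * ?p i) \<le> t * nsq w" .
    have "(\<Sum>i<n. - d i * ?p i) \<le> (\<Sum>i<n. y i * ?p i)"
    proof (intro sum_mono mult_right_mono)
      fix i assume "i \<in> {..<n}"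
      then show "- d i \<le> y i" "0 \<le> ?p i"
        using y tau_pos[of i] by (auto simp: orthant_def X_def less_imp_le dest: spec[of _ i])
    qed
    then have 2: "- (\<Sum>i<n. d i * ?p i) \<le> (\<Sum>i<n. y i * ?p i)" by (simp add: sum_negf)
    have "(\<Sum>i<n. (y(j := y j + r)) i * ?p i) = (\<Sum>i<n. y i * ?p i + (if i = j then r * ?p i else 0))"
      by (intro sum.cong) (auto simp: algebra_simps)
    also have "\<dots> = (\<Sum>i<n. y i * ?p i) + r * ?p j" using j by (simp add: sum.distrib)
    finally have 3: "(\<Sum>i<n. (y(j := y j + r)) i * ?p i) = (\<Sum>i<n. y i * ?p i) + r * ?p j" .
    have "qform (M (\<lambda>k. of_real ((y(j := y j + r)) k))) w
        = of_real (x * nsq w + (\<Sum>i<n. (y(j := y j + r)) i * ?p i))"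
      unfolding qform_M by (simp only: of_real_add of_real_mult of_real_sum)
    then have "Re (qform (M (\<lambda>k. of_real ((y(j := y j + r)) k))) w)
        = x * nsq w + (\<Sum>i<n. (y(j := y j + r)) i * ?p i)" by (simp only: Re_complex_of_real)
    then show ?thesis unfolding 3 using 1 2 by (simp add: algebra_simps)
  qed
  show ?thesis
  \<comment> \<open>Without variables \<open>f\<close> is constant and stability alone gives the
    claim; otherwise index 0 is available for \<open>q\<close>.\<close>
  proof (cases "n = 0")
    case True
    have "stable f" using real_stable_det_M by (simp add: real_stable_def f_def)
    moreover have "f (\<lambda>_. \<i>) = f (\<lambda>_. 0)" unfolding f_def M_def using True by simp
    moreover have "f (\<lambda>_. \<i>) \<noteq> 0" using \<open>stable f\<close> by (simp add: stable_def)
    ultimately show ?thesis using True by (simp add: f_def)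
  next
    case n: False
    show ?thesis
      unfolding f_def[symmetric]
    proof (rule ops_nonzero[where d = d and b = b, OF _ _ _ X_def])
      show "real_stable f" unfolding f_def by (rule real_stable_det_M)
      show "0 < d i \<and> d i < 1" if "i < n" for i
      proof (cases "v i = 0")
        case False
        have "t * s i \<le> t * 1" using s[OF that False] t by (intro mult_left_mono) auto
        then have "t * s i < 1" using t by linarith
        then show ?thesis using False s[OF that False] t by (simp add: d_def)
      qed (simp add: d_def)
      show "b i * (1 / d i - d i) < 1" if "i < n" for i
      proof (cases "v i = 0")
        case True
        then show ?thesis by (simp add: b_def s_def nsq_def)
      next
        case False
        have si: "0 < s i" by (rule s(1)[OF that False])
        have di: "d i = t * s i" using False by (simp add: d_def)
        have "0 < b i" unfolding b_def using si xt by simp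
        \<comment> \<open>After dropping \<open>- d i\<close> the factor \<open>s i\<close> cancels,
          and \<open>t * (x - t) > 2\<close> is exactly what remains to be used.\<close>
        moreover have "1 / d i - d i < 1 / d i" unfolding di using si t(1) by simp
        ultimately have "b i * (1 / d i - d i) < b i * (1 / d i)" by (rule mult_strict_left_mono[rotated])
        also have "\<dots> = 2 / (t * (x - t))"
          unfolding di b_def using si by simp
        also have "\<dots> < 1" using t(3) by simp
        finally show ?thesis .
      qed
      show "restrict_real f y > 0" if y: "y \<in> orthant 0 n X" for y
      proof -
        let ?M = "M (\<lambda>k. of_real (y k))"
        have "qform ?M w \<noteq> 0" if "w \<noteq> 0" for w
        proof
          assume "qform ?M w = 0"
          then have "(x - t) * nsq w \<le> 0" using q[OF y, of 0 w 0] n by simp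
          then show False using nsq_pos[OF that] xt by (simp add: mult_le_0_iff)
        qed
        then have "det ?M \<noteq> 0" by (rule det_nonzero_if_qform)
        moreover obtain r where "det ?M = of_real r" using det_M_real[of y] by (auto elim: Reals_cases)
        ultimately show ?thesis by (simp add: restrict_real_def f_def flip: of_real_power)
      qed
      show "D j (restrict_real f) X \<le> b j * restrict_real f X" if j: "j < n" for j
      proof -
        let ?g = "\<lambda>r. det (M (\<lambda>k. of_real ((X(j := X j + r)) k)))"
        obtain a' b' where ab': "\<And>t. det (M ((\<lambda>k. of_real (X k))(j := t))) = a' + b' * t"
          using det_M_upd by blast
        define \<alpha> where "\<alpha> = Re (a' + b' * of_real (X j))"
        define \<beta> where "\<beta> = Re b'"
        have g: "?g r = of_real (\<alpha> + \<beta> * r)" for r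
        proof -
          have "?g r = of_real (Re (?g r))" by (simp only: of_real_Re[OF det_M_real])
          also have "Re (?g r) = \<alpha> + \<beta> * r"
            unfolding of_real_fun_upd ab' by (simp add: \<alpha>_def \<beta>_def algebra_simps)
          finally show ?thesis .
        qed
        have F: "restrict_real f (X(j := X j + r)) = (\<alpha> + \<beta> * r)^2" for r
          unfolding restrict_real_def f_def g by (simp flip: of_real_power)
        have FX: "restrict_real f X = \<alpha>^2" using F[of 0] by simp
        have DX: "D j (restrict_real f) X = 2 * \<alpha> * \<beta>"
          using F[of 1] F[of "-1"] by (simp add: D_def power2_eq_square algebra_simps)
        \<comment> \<open>The rank one term helps for \<open>r \<ge> 0\<close>; for
          \<open>r < 0\<close> Cauchy-Schwarz limits its damage to \<open>s j * nsq w\<close>. The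
          factor \<open>min 0 r\<close> covers both signs.\<close>
        have nz: "\<alpha> + \<beta> * r \<noteq> 0" if r: "(x - t) + min 0 r * s j > 0" for r
        proof -
          have "qform (M (\<lambda>k. of_real ((X(j := X j + r)) k))) w \<noteq> 0" if w: "w \<noteq> 0" for w
          proof -
            have tj: "0 < \<tau> j" by (rule tau_pos[OF j])
            have "\<tau> j * (cmod (ip (v j) w))^2 \<le> s j * nsq w"
              using ip_Cauchy_Schwarz[of "v j" w] tj by (simp add: s_def mult.assoc)
            then have "min 0 r * (s j * nsq w) \<le> min 0 r * (\<tau> j * (cmod (ip (v j) w))^2)"
              by (intro mult_left_mono_neg) auto
            also have "\<dots> \<le> r * (\<tau> j * (cmod (ip (v j) w))^2)"
              using tj by (intro mult_right_mono) auto
            also have "(x - t) * nsq w + \<dots> \<le> Re (qform (M (\<lambda>k. of_real ((X(j := X j + r)) k))) w)"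
              by (rule q[OF _ j]) (simp add: orthant_def)
            finally have "((x - t) + min 0 r * s j) * nsq w \<le> Re (qform (M (\<lambda>k. of_real ((X(j := X j + r)) k))) w)"
              by (simp add: algebra_simps)
            moreover have "((x - t) + min 0 r * s j) * nsq w > 0" using r nsq_pos[OF w] by simp
            ultimately show ?thesis by auto
          qed
          then have "?g r \<noteq> 0" by (rule det_nonzero_if_qform)
          then show ?thesis unfolding g of_real_eq_0_iff .
        qed
        have "\<alpha> + \<beta> * 0 \<noteq> 0" by (rule nz) (use xt in simp)
        then have \<alpha>: "\<alpha> \<noteq> 0" by simp
        \<comment> \<open>A larger ratio \<open>u\<close> would give the affine function
          \<open>\<alpha> + \<beta> * r\<close> a zero at \<open>r = - 1 / u\<close>, which
          \<open>nz\<close> excludes since \<open>s j / u < x - t\<close>. Squaring the determinant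
          doubles the ratio, hence the 2 in \<open>b\<close>.\<close>
        have "\<beta> / \<alpha> \<le> s j / (x - t)"
        proof (rule ccontr)
          assume "\<not> \<beta> / \<alpha> \<le> s j / (x - t)"
          have "0 \<le> s j" unfolding s_def using tau_pos[OF j] nsq_nonneg[of "v j"] by simp
          then have "0 \<le> s j / (x - t)" using xt by (rule divide_nonneg_pos)
          define u where "u = \<beta> / \<alpha>"
          have lt: "s j / (x - t) < u" unfolding u_def using \<open>\<not> \<beta> / \<alpha> \<le> s j / (x - t)\<close> by (simp only: not_le)
          then have u: "0 < u" using \<open>0 \<le> s j / (x - t)\<close> by linarith
          have "s j < u * (x - t)" using lt by (simp only: pos_divide_less_eq[OF xt])
          then have "s j / u < x - t" by (simp only: pos_divide_less_eq[OF u] mult.commute)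
          moreover have "min 0 (- 1 / u) * s j = - (s j / u)" using u by (simp add: min_def)
          ultimately have "(x - t) + min 0 (- 1 / u) * s j > 0" by linarith
          then have "\<alpha> + \<beta> * (- 1 / u) \<noteq> 0" by (rule nz)
          moreover have "\<beta> = u * \<alpha>" using \<alpha> by (simp add: u_def)
          ultimately show False using u by simp
        qed
        then have "2 * \<alpha>^2 * (\<beta> / \<alpha>) \<le> 2 * \<alpha>^2 * (s j / (x - t))" by (intro mult_left_mono) auto
        moreover have "2 * \<alpha>^2 * (\<beta> / \<alpha>) = 2 * \<alpha> * \<beta>" using \<alpha> by (simp add: power2_eq_square)
        moreover have "2 * \<alpha>^2 * (s j / (x - t)) = 2 * s j / (x - t) * \<alpha>^2" by simp
        ultimately show ?thesis unfolding DX FX b_def by linarith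
      qed
    qed
  qed
qed

end

theorem theorem4p1:
  fixes n :: nat and v :: "nat \<Rightarrow> complex ^'d" and \<tau> :: "nat \<Rightarrow> real"
  assumes tau_pos: "\<And>i. i < n \<Longrightarrow> \<tau> i > 0"
    and bound: "loewner_le (\<Sum>i<n. scaleM (complex_of_real ((\<tau> i)^2)) (outer (v i) ** outer (v i))) (mat 1)"
  shows "\<forall>x::real. p_empty n \<tau> v (complex_of_real x) = 0 \<longrightarrow> x \<le> 3"
proof (intro allI impI, rule ccontr)
  fix x :: real
  assume root: "p_empty n \<tau> v (complex_of_real x) = 0" and "\<not> x \<le> 3"
  \<comment> \<open>Evaluating the quadratic form of the Loewner hypothesis at \<open>w\<close>
    supplies the assumption \<open>bound\<close> of the locale.\<close>
  have "(\<Sum>i<n. (\<tau> i)^2 * nsq (v i) * (cmod (ip (v i) w))^2) \<le> nsq w" for w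
  proof -
    let ?A = "\<Sum>i<n. scaleM (complex_of_real ((\<tau> i)^2)) (outer (v i) ** outer (v i))"
    have "0 \<le> Re (qform (mat 1 - ?A) w)"
      using bound unfolding loewner_le_def psd_def by blast
    also have "qform (mat 1 - ?A) w
        = of_real (nsq w - (\<Sum>i<n. (\<tau> i)^2 * nsq (v i) * (cmod (ip (v i) w))^2))"
      by (simp add: qform_diff qform_mat qform_sum qform_scaleM outer_mult_outer qform_outer mult.assoc)
    finally show ?thesis by simp
  qed
  then interpret rank_one_family n \<tau> v x
    using tau_pos \<open>\<not> x \<le> 3\<close> by unfold_locales auto
  show False
    using ops_det_M_nonzero root unfolding p_empty_def M_def by simp
qed

end
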